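(* Let $\mathcal{G}=(\mathcal{N},\mathcal{E})$ be a directed graph with node set $\mathcal{N}=\{1,\dots,n\}$, $n\ge 2$, with row-stochastic-type matrix $P$ and dangling-node vector $\mathbf{d}$ as defined in the context, let $\alpha\in(0,1)$ be a fixed damping factor and $\mathbf{u}\in\mathbb{R}^n$ a fixed dangling node distribution ($\mathbf{u}>0$, $\mathbf{u}^T\mathbf{e}=1$). Let $X=(x_{ij})=(1-\alpha)\bigl(I_n-\alpha(P+\mathbf{d}\mathbf{u}^T)\bigr)^{-1}$. Then for each node $i\in\mathcal{N}$, $$\mathcal{PR}(i)=\Bigl(\min_j x_{ji},\ x_{ii}\Bigr),$$ an open interval, where $\mathcal{PR}(i)=\{\pi(\mathbf{v})^T\mathbf{e}_i:\ \mathbf{v}\in\mathbb{R}^n,\ \mathbf{v}>0,\ \mathbf{v}^T\mathbf{e}=1\}$ is the set of all possible values of the personalized PageRank of node $i$.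
   Context: The adjacency matrix $A=(a_{ij})$ of $\mathcal{G}$ has $a_{ij}=1$ if $(i,j)\in\mathcal{E}$ and $0$ otherwise; $k_{out}(i)=\sum_k a_{ik}$. A node $i$ is dangling if $k_{out}(i)=0$. The matrix $P=(p_{ij})$ has $p_{ij}=0$ for all $j$ if $i$ is dangling, and $p_{ij}=a_{ij}/k_{out}(i)$ otherwise. $\mathbf{d}\in\mathbb{R}^n$ has $d_i=1$ if $i$ is dangling and $d_i=0$ otherwise. $\mathbf{e}_1,\dots,\mathbf{e}_n$ are the standard basis column vectors and $\mathbf{e}=(1,\dots,1)^T$; $\mathbf{v}>0$ means all components are positive. A personalization vector is $\mathbf{v}\in\mathbb{R}^n$ with $\mathbf{v}>0$, $\mathbf{v}^T\mathbf{e}=1$. The Google matrix is $G=\alpha(P+\mathbf{d}\mathbf{u}^T)+(1-\alpha)\mathbf{e}\mathbf{v}^T$, and the personalized PageRank vector $\pi(\mathbf{v})$ is the unique vector with $\pi(\mathbf{v})>0$, $\pi(\mathbf{v})^T\mathbf{e}=1$, $\pi(\mathbf{v})^TG=\pi(\mathbf{v})^T$; equivalently $\pi(\mathbf{v})^T=\mathbf{v}^TX$ with $X$ as in the claim. *)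

theory Defs
  imports "HOL-Analysis.Analysis"
begin

text \<open>
  The node set is a finite type \<open>'n\<close>, so \<open>n\<close> is \<open>CARD('n)\<close>. A directed graph is given by an
  arbitrary edge relation on the nodes; loops are permitted.
\<close>

definition adjacency :: "('n::finite \<times> 'n) set \<Rightarrow> real^'n^'n" where
  "adjacency E = (\<chi> i j. if (i, j) \<in> E then 1 else 0)"

definition out_degree :: "('n::finite \<times> 'n) set \<Rightarrow> 'n \<Rightarrow> real" where
  "out_degree E i = (\<Sum>k\<in>UNIV. adjacency E $ i $ k)"

definition dangling :: "('n::finite \<times> 'n) set \<Rightarrow> 'n \<Rightarrow> bool" where
  "dangling E i \<longleftrightarrow> out_degree E i = 0"

definition transition_matrix :: "('n::finite \<times> 'n) set \<Rightarrow> real^'n^'n" where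
  "transition_matrix E =
     (\<chi> i j. if dangling E i then 0 else adjacency E $ i $ j / out_degree E i)"

definition dangling_vec :: "('n::finite \<times> 'n) set \<Rightarrow> real^'n" where
  "dangling_vec E = (\<chi> i. if dangling E i then 1 else 0)"

text \<open>The rank-one matrix \<open>x y\<^sup>T\<close>.\<close>

definition outer :: "real^'n \<Rightarrow> real^'m \<Rightarrow> real^'m^'n" where
  "outer x y = (\<chi> i j. x $ i * y $ j)"

text \<open>
  Positivity is spelled out because \<open>0 < w\<close> on \<^typ>\<open>real^'n\<close> only means that \<open>w\<close> is
  nonnegative in each component and nonzero. The all-ones vector is \<open>vec 1\<close>.
\<close>

definition positive_distribution :: "real^'n \<Rightarrow> bool" where
  "positive_distribution w \<longleftrightarrow> (\<forall>i. 0 < w $ i) \<and> w \<bullet> vec 1 = 1"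

definition google_matrix ::
  "('n::finite \<times> 'n) set \<Rightarrow> real \<Rightarrow> real^'n \<Rightarrow> real^'n \<Rightarrow> real^'n^'n" where
  "google_matrix E \<alpha> u v =
     \<alpha> *\<^sub>R (transition_matrix E + outer (dangling_vec E) u) + (1 - \<alpha>) *\<^sub>R outer (vec 1) v"

definition pagerank ::
  "('n::finite \<times> 'n) set \<Rightarrow> real \<Rightarrow> real^'n \<Rightarrow> real^'n \<Rightarrow> real^'n" where
  "pagerank E \<alpha> u v =
     (THE p. positive_distribution p \<and> p v* google_matrix E \<alpha> u v = p)"

definition pagerank_values ::
  "('n::finite \<times> 'n) set \<Rightarrow> real \<Rightarrow> real^'n \<Rightarrow> 'n \<Rightarrow> real set" where
  "pagerank_values E \<alpha> u i =
     {pagerank E \<alpha> u v \<bullet> axis i 1 | v. positive_distribution v}"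

end

theory Submission
  imports Defs
begin

text \<open>
  Write \<open>S = P + d u\<^sup>T\<close>, a row-stochastic matrix. Column \<open>i\<close> of \<open>X\<close> is the solution \<open>c\<close> of
  \<open>c = \<alpha> S c + (1 - \<alpha>) e\<^sub>i\<close>; the maximum principle for this equation gives \<open>c \<ge> 0\<close> and shows that
  the maximum of \<open>c\<close> is attained at \<open>i\<close> only. As \<open>\<pi>(v)\<^sub>i = v \<bullet> c\<close>, the values of the PageRank of
  \<open>i\<close> are the weighted means of the entries of \<open>c\<close> with positive weights.
\<close>

section \<open>Weighted means with positive weights\<close>

lemma positive_distribution_iff:
  "positive_distribution w \<longleftrightarrow> (\<forall>i. 0 < w $ i) \<and> (\<Sum>i\<in>UNIV. w $ i) = 1"
  by (simp add: positive_distribution_def inner_vec_def)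

lemma ex_max_component:
  fixes x :: "real^'n"
  obtains m where "\<And>k. x $ k \<le> x $ m"
proof -
  have "Max (range (($) x)) \<in> range (($) x)" by (rule Max_in) auto
  then obtain m where "x $ m = Max (range (($) x))" by (metis imageE)
  then show thesis by (intro that[of m]) simp
qed

text \<open>The mean is strictly below the bound because the entry at \<open>k\<close> carries
  positive weight. Applied to \<open>- c\<close>, this also gives strict lower bounds.\<close>

lemma positive_distribution_inner_less:
  assumes w: "positive_distribution w" and le: "\<And>j. c $ j \<le> b" and lt: "c $ k < b"
  shows "w \<bullet> c < b"
proof -
  have "w \<bullet> c < (\<Sum>j\<in>UNIV. w $ j * b)"
    unfolding inner_vec_def inner_real_def
    using w le lt by (intro sum_strict_mono_ex1)
      (auto simp: positive_distribution_iff less_imp_le intro!: mult_left_mono exI[of _ k])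
  also have "\<dots> = b"
    using w by (simp add: positive_distribution_iff flip: sum_distrib_right)
  finally show ?thesis .
qed

lemma ex_positive_distribution_inner_eq:
  assumes w: "positive_distribution w" and t: "w \<bullet> c \<le> t" "t < c $ k"
  obtains v where "positive_distribution v" "v \<bullet> c = t"
proof
  \<comment> \<open>On the segment from \<open>w\<close> to the vertex \<open>axis k 1\<close>, the
    mean of \<open>c\<close> varies affinely from \<open>w \<bullet> c\<close> to
    \<open>c $ k\<close>; \<theta> is the parameter at which it equals \<open>t\<close>. Since
    \<open>t < c $ k\<close>, the vertex itself is not reached, so the share of \<open>w\<close>
    keeps every weight positive.\<close>
  define \<theta> where "\<theta> = (t - w \<bullet> c) / (c $ k - w \<bullet> c)"
  have \<theta>: "0 \<le> \<theta>" "\<theta> < 1" "\<theta> * (c $ k - w \<bullet> c) = t - w \<bullet> c"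
    using t by (auto simp: \<theta>_def field_simps)
  define v where "v = (1 - \<theta>) *\<^sub>R w + \<theta> *\<^sub>R axis k 1"
  have "(\<Sum>j\<in>UNIV. v $ j) = (1 - \<theta>) * (\<Sum>j\<in>UNIV. w $ j) + \<theta> * (\<Sum>j\<in>UNIV. axis k 1 $ j)"
    by (simp add: v_def sum.distrib sum_distrib_left)
  also have "\<dots> = 1"
    using w by (simp add: positive_distribution_iff axis_def)
  finally show "positive_distribution v"
    using w \<theta> by (auto simp: positive_distribution_iff v_def axis_def add_pos_nonneg)
  show "v \<bullet> c = t"
    using \<theta>(3) by (simp add: v_def inner_add_left inner_axis' algebra_simps)
qed

lemma positive_distribution_inner_values:
  fixes c :: "real^'n"
  assumes lo: "\<And>j. c $ k \<le> c $ j" and hi: "\<And>j. c $ j \<le> c $ i" and less: "c $ k < c $ i"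
  shows "{v \<bullet> c | v. positive_distribution v} = {c $ k<..<c $ i}"
proof (intro equalityI subsetI)
  fix t assume "t \<in> {v \<bullet> c | v. positive_distribution v}"
  then obtain v where v: "positive_distribution v" and t: "t = v \<bullet> c" by blast
  have "v \<bullet> c < c $ i"
    using positive_distribution_inner_less[OF v hi less] .
  moreover have "v \<bullet> - c < - c $ k"
    using lo less by (intro positive_distribution_inner_less[OF v, where k = i]) auto
  ultimately show "t \<in> {c $ k<..<c $ i}" by (simp add: t)
next
  fix t assume t: "t \<in> {c $ k<..<c $ i}"
  \<comment> \<open>Every target value is reached from the uniform distribution: values from its
    mean upwards by moving towards vertex \<open>i\<close>, smaller ones by moving towards vertex
    \<open>k\<close>.\<close>
  define w :: "real^'n" where "w = vec (1 / CARD('n))"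
  have w: "positive_distribution w" by (simp add: positive_distribution_iff w_def)
  show "t \<in> {v \<bullet> c | v. positive_distribution v}"
  proof (cases "w \<bullet> c \<le> t")
    case True
    then show ?thesis
      using t ex_positive_distribution_inner_eq[OF w True, of i] by auto
  next
    case False
    \<comment> \<open>Negating \<open>c\<close> turns the minimum at \<open>k\<close> into a
      maximum, so the same segment argument covers values below the uniform mean.\<close>
    then obtain v where "positive_distribution v" "v \<bullet> - c = - t"
      using t ex_positive_distribution_inner_eq[OF w, of "- c" "- t" k] by auto
    then show ?thesis by auto
  qed
qed

section \<open>Row-stochastic matrices and the patched transition matrix\<close>

definition row_stochastic :: "real^'n^'n \<Rightarrow> bool" where
  "row_stochastic S \<longleftrightarrow> (\<forall>i j. 0 \<le> S $ i $ j) \<and> S *v 1 = 1"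

lemma row_stochastic_sum:
  "row_stochastic S \<Longrightarrow> (\<Sum>k\<in>UNIV. S $ j $ k) = 1"
  by (auto simp: row_stochastic_def matrix_vector_mult_def vec_eq_iff)

lemma row_stochastic_mult_le:
  assumes S: "row_stochastic S" and le: "\<And>k. x $ k \<le> b"
  shows "(S *v x) $ j \<le> b"
proof -
  have "(S *v x) $ j \<le> (\<Sum>k\<in>UNIV. S $ j $ k * b)"
    using S le by (auto simp: matrix_vector_mult_def row_stochastic_def
        intro!: sum_mono mult_left_mono)
  also have "\<dots> = b" by (simp add: row_stochastic_sum[OF S] flip: sum_distrib_right)
  finally show ?thesis .
qed

text \<open>A dangling row equals \<open>u\<close>; any other row is an adjacency row divided by its
  nonzero sum.\<close>

lemma row_stochastic_transition:
  assumes u: "positive_distribution u"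
  shows "row_stochastic (transition_matrix E + outer (dangling_vec E) u)"
proof -
  have pos: "0 \<le> out_degree E i" for i
    by (simp add: out_degree_def adjacency_def sum_nonneg)
  have "(\<Sum>j\<in>UNIV. adjacency E $ i $ j / out_degree E i) = 1" if "\<not> dangling E i" for i
    using that by (simp add: dangling_def out_degree_def flip: sum_divide_distrib)
  then show ?thesis
    using u pos
    by (auto simp: row_stochastic_def transition_matrix_def outer_def dangling_vec_def
        adjacency_def positive_distribution_iff matrix_vector_mult_def vec_eq_iff less_imp_le)
qed

section \<open>Maximum principle for the resolvent equation\<close>

lemma resolvent_eq:
  fixes S :: "real^'n^'n"
  shows "(mat 1 - \<alpha> *\<^sub>R S) *v x = x - \<alpha> *\<^sub>R (S *v x)"
  by (simp add: matrix_vector_mult_diff_rdistrib flip: scaleR_matrix_vector_assoc)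

context
  fixes S :: "real^'n^'n" and \<alpha> :: real
  assumes S: "row_stochastic S" and \<alpha>: "0 < \<alpha>" "\<alpha> < 1"
begin

text \<open>At an index \<open>m\<close> where \<open>x\<close> is maximal, averaging by
  \<open>S\<close> cannot exceed \<open>x $ m\<close>, so
  \<open>x $ m \<le> \<alpha> * x $ m\<close>; as \<alpha> < 1, the maximum is not positive.\<close>

lemma resolvent_nonpos:
  assumes b: "\<And>j. ((mat 1 - \<alpha> *\<^sub>R S) *v x) $ j \<le> 0"
  shows "x $ j \<le> 0"
proof -
  obtain m where m: "\<And>k. x $ k \<le> x $ m"
    using ex_max_component[of x] by blast
  have "x $ m \<le> \<alpha> * (S *v x) $ m"
    using b[of m] by (simp add: resolvent_eq)
  also have "\<dots> \<le> \<alpha> * x $ m"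
    using \<alpha> row_stochastic_mult_le[OF S m] by simp
  finally have "(1 - \<alpha>) * x $ m \<le> 0" by (simp add: algebra_simps)
  then have "x $ m \<le> 0" using \<alpha> by (simp add: mult_le_0_iff)
  with m[of j] show ?thesis by simp
qed

lemma resolvent_nonneg:
  assumes "\<And>j. 0 \<le> ((mat 1 - \<alpha> *\<^sub>R S) *v x) $ j"
  shows "0 \<le> x $ j"
  using resolvent_nonpos[of "- x" j] assms matrix_vector_mult_diff_distrib[of "mat 1 - \<alpha> *\<^sub>R S" 0 x]
  by simp

text \<open>A kernel vector satisfies both sign conditions of the maximum principle and hence
  vanishes.\<close>

lemma invertible_resolvent: "invertible (mat 1 - \<alpha> *\<^sub>R S)"
proof -
  have "x = 0" if "(mat 1 - \<alpha> *\<^sub>R S) *v x = 0" for x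
    using resolvent_nonpos[of x] resolvent_nonneg[of x] that
    by (simp add: vec_eq_iff order_antisym)
  then show ?thesis
    by (simp add: invertible_left_inverse matrix_left_invertible_ker)
qed

lemma resolvent_axis_pos:
  assumes c: "(mat 1 - \<alpha> *\<^sub>R S) *v c = b *\<^sub>R axis i 1" and b: "0 < b"
  shows "0 \<le> c $ j" and "0 < c $ i"
proof -
  show nonneg: "0 \<le> c $ k" for k
    by (rule resolvent_nonneg) (use b in \<open>simp add: c axis_def\<close>)
  have "0 \<le> (S *v c) $ i"
    using S nonneg by (auto simp: matrix_vector_mult_def row_stochastic_def intro!: sum_nonneg)
  moreover have "c $ i = \<alpha> * (S *v c) $ i + b"
    using arg_cong[OF c, of "\<lambda>x. x $ i"] by (simp add: resolvent_eq)
  ultimately show "0 < c $ i"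
    using \<alpha> b by (simp add: add_nonneg_pos)
qed

text \<open>Away from \<open>i\<close> the source term vanishes, so each entry is \<alpha> times an
  average of entries of \<open>c\<close>. This is at most \<alpha> times the maximum, which is
  strictly smaller than the maximum because the latter is positive.\<close>

lemma resolvent_max_unique:
  assumes c: "(mat 1 - \<alpha> *\<^sub>R S) *v c = b *\<^sub>R axis i 1" and b: "0 < b"
    and "j \<noteq> i"
  shows "c $ j < c $ i"
proof -
  obtain m where m: "\<And>k. c $ k \<le> c $ m"
    using ex_max_component[of c] by blast
  have "0 < c $ m"
    using resolvent_axis_pos(2)[OF c b] m[of i] by simp
  then have lt: "\<alpha> * c $ m < c $ m" using \<alpha> by simp
  have less: "c $ k < c $ m" if "k \<noteq> i" for k
  proof -
    have "c $ k = \<alpha> * (S *v c) $ k"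
      using that arg_cong[OF c, of "\<lambda>x. x $ k"] by (simp add: resolvent_eq axis_def)
    also have "\<dots> \<le> \<alpha> * c $ m"
      using \<alpha> row_stochastic_mult_le[OF S m] by simp
    finally show ?thesis using lt by simp
  qed
  \<comment> \<open>Otherwise \<open>less\<close> at \<open>m\<close> itself would read
    \<open>c $ m < c $ m\<close>.\<close>
  then have "m = i" by blast
  with less \<open>j \<noteq> i\<close> show ?thesis by simp
qed

section \<open>The matrix \<open>X\<close> and the stationarity equation\<close>

lemma resolvent_inverse:
  assumes X: "X = (1 - \<alpha>) *\<^sub>R matrix_inv (mat 1 - \<alpha> *\<^sub>R S)"
  shows "(mat 1 - \<alpha> *\<^sub>R S) ** X = (1 - \<alpha>) *\<^sub>R mat 1"
    and "X ** (mat 1 - \<alpha> *\<^sub>R S) = (1 - \<alpha>) *\<^sub>R mat 1"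
proof -
  let ?M = "mat 1 - \<alpha> *\<^sub>R S"
  \<comment> \<open>\<open>matrix_inv\<close> is a Hilbert choice, so both identities follow from
    the existence of a two-sided inverse.\<close>
  have "?M ** matrix_inv ?M = mat 1 \<and> matrix_inv ?M ** ?M = mat 1"
    using invertible_resolvent unfolding invertible_def matrix_inv_def by (rule someI_ex)
  then show "?M ** X = (1 - \<alpha>) *\<^sub>R mat 1" "X ** ?M = (1 - \<alpha>) *\<^sub>R mat 1"
    unfolding X by (simp_all add: matrix_scalar_ac flip: scalar_matrix_assoc)
qed

text \<open>The equation on the left is what stationarity under the Google matrix becomes for a
  vector of total mass one. It reads \<open>p v* (mat 1 - \<alpha> *\<^sub>R S) = (1 - \<alpha>)
  *\<^sub>R v\<close>, solved by multiplying with \<open>X\<close> from the right.\<close>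

lemma pagerank_fixpoint_iff:
  assumes X: "X = (1 - \<alpha>) *\<^sub>R matrix_inv (mat 1 - \<alpha> *\<^sub>R S)"
  shows "p - \<alpha> *\<^sub>R (p v* S) = (1 - \<alpha>) *\<^sub>R v \<longleftrightarrow> p = v v* X"
proof -
  let ?M = "mat 1 - \<alpha> *\<^sub>R S"
  have M: "p - \<alpha> *\<^sub>R (p v* S) = p v* ?M"
    by (simp add: vector_matrix_mult_diff_rdistrib vector_scaleR_matrix_ac)
  have sc: "x v* ((1 - \<alpha>) *\<^sub>R mat 1) = (1 - \<alpha>) *\<^sub>R x" for x :: "real^'n"
    by (simp add: vector_scaleR_matrix_ac)
  show ?thesis
  proof
    assume "p - \<alpha> *\<^sub>R (p v* S) = (1 - \<alpha>) *\<^sub>R v"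
    then have "p v* ?M v* X = ((1 - \<alpha>) *\<^sub>R v) v* X" by (simp only: M)
    then have "(1 - \<alpha>) *\<^sub>R p = (1 - \<alpha>) *\<^sub>R (v v* X)"
      by (simp add: vector_matrix_mul_assoc resolvent_inverse(1)[OF X] sc
          scaleR_vector_matrix_assoc)
    then show "p = v v* X" using \<alpha> by simp
  next
    assume "p = v v* X"
    then show "p - \<alpha> *\<^sub>R (p v* S) = (1 - \<alpha>) *\<^sub>R v"
      unfolding M by (simp add: vector_matrix_mul_assoc resolvent_inverse(2)[OF X] sc)
  qed
qed

lemma resolvent_column:
  assumes X: "X = (1 - \<alpha>) *\<^sub>R matrix_inv (mat 1 - \<alpha> *\<^sub>R S)"
  shows "(mat 1 - \<alpha> *\<^sub>R S) *v column i X = (1 - \<alpha>) *\<^sub>R axis i 1"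
proof -
  have "(mat 1 - \<alpha> *\<^sub>R S) *v column i X = ((mat 1 - \<alpha> *\<^sub>R S) ** X) *v axis i 1"
    unfolding matrix_vector_mul_assoc[symmetric] by (simp add: matrix_vector_mult_basis)
  then show ?thesis
    by (simp add: resolvent_inverse(1)[OF X] scaleR_matrix_vector_assoc[symmetric])
qed

text \<open>Each entry is at least its diagonal contribution \<open>v $ i * X $ i $ i\<close>,
  positive because columns of \<open>X\<close> are nonnegative with positive diagonal entry. The
  mass is preserved because \<open>X\<close> fixes the all-ones vector.\<close>

lemma positive_distribution_mult_resolvent:
  assumes X: "X = (1 - \<alpha>) *\<^sub>R matrix_inv (mat 1 - \<alpha> *\<^sub>R S)" and v: "positive_distribution v"
  shows "positive_distribution (v v* X)"
proof -
  have "0 < (v v* X) $ i" for i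
  proof -
    have "0 < v $ i * X $ i $ i"
      using v \<alpha> resolvent_axis_pos(2)[OF resolvent_column[OF X, of i]]
      by (simp add: positive_distribution_iff column_def)
    also have "\<dots> \<le> (\<Sum>j\<in>UNIV. v $ j * X $ j $ i)"
      using v \<alpha> resolvent_axis_pos(1)[OF resolvent_column[OF X, of i]]
      by (intro member_le_sum[where f = "\<lambda>j. v $ j * X $ j $ i"])
        (auto simp: positive_distribution_iff column_def less_imp_le)
    finally show ?thesis by (simp add: vector_matrix_mult_def mult.commute)
  qed
  moreover have "(v v* X) \<bullet> 1 = 1"
  proof -
    \<comment> \<open>The all-ones vector is an eigenvector of the resolvent matrix for the
      eigenvalue 1 - \<alpha>, which cancels the factor in \<open>X\<close>.\<close>
    have "(mat 1 - \<alpha> *\<^sub>R S) *v 1 = (1 - \<alpha>) *\<^sub>R 1"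
      using S by (simp add: resolvent_eq row_stochastic_def scaleR_diff_left)
    then have "(1 - \<alpha>) *\<^sub>R (X *v 1) = X *v ((mat 1 - \<alpha> *\<^sub>R S) *v 1)"
      by (simp add: matrix_vector_mult_scaleR)
    also have "\<dots> = (1 - \<alpha>) *\<^sub>R 1"
      by (simp add: matrix_vector_mul_assoc resolvent_inverse(2)[OF X]
          flip: scaleR_matrix_vector_assoc)
    finally have "X *v 1 = 1" using \<alpha> by simp
    then show ?thesis using v by (simp add: dot_lmul_matrix positive_distribution_def)
  qed
  ultimately show ?thesis by (simp add: positive_distribution_def)
qed

end

section \<open>PageRank as \<open>v v* X\<close> and its range\<close>

lemma vector_outer_mult: "p v* outer x y = (p \<bullet> x) *\<^sub>R y"
  by (simp add: vec_eq_iff vector_matrix_mult_def outer_def inner_vec_def sum_distrib_left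
      sum_distrib_right mult_ac)

lemma pagerank_eq:
  assumes \<alpha>: "0 < \<alpha>" "\<alpha> < 1" and u: "positive_distribution u" and v: "positive_distribution v"
    and X: "X = (1 - \<alpha>) *\<^sub>R
           matrix_inv (mat 1 - \<alpha> *\<^sub>R (transition_matrix E + outer (dangling_vec E) u))"
  shows "pagerank E \<alpha> u v = v v* X"
proof -
  let ?S = "transition_matrix E + outer (dangling_vec E) u"
  note S = row_stochastic_transition[OF u]
  have "p v* google_matrix E \<alpha> u v = p \<longleftrightarrow> p = v v* X" if p: "positive_distribution p" for p
  proof -
    \<comment> \<open>Since \<open>p\<close> has mass one, the teleportation term contributes the
      constant \<open>(1 - \<alpha>) *\<^sub>R v\<close>, so the eigenvector equation becomes an
      affine one.\<close>
    have "p v* google_matrix E \<alpha> u v = \<alpha> *\<^sub>R (p v* ?S) + (1 - \<alpha>) *\<^sub>R v"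
      using p unfolding google_matrix_def vector_matrix_mult_add_rdistrib[of _ "\<alpha> *\<^sub>R ?S"]
      by (simp add: vector_scaleR_matrix_ac vector_outer_mult positive_distribution_def)
    moreover have "p = (1 - \<alpha>) *\<^sub>R v + \<alpha> *\<^sub>R (p v* ?S) \<longleftrightarrow> p = v v* X"
      using pagerank_fixpoint_iff[OF S \<alpha> X] by (simp only: diff_eq_eq)
    ultimately show ?thesis by (metis add.commute)
  qed
  moreover have "positive_distribution (v v* X)"
    by (rule positive_distribution_mult_resolvent[OF S \<alpha> X v])
  ultimately show ?thesis
    unfolding pagerank_def by (intro the_equality) auto
qed

theorem theorem1:
  fixes E :: "('n::finite \<times> 'n) set"
    and \<alpha> :: real
    and u :: "real^'n"
    and X :: "real^'n^'n"
    and i :: 'n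
  assumes "CARD('n) \<ge> 2"
    and "0 < \<alpha>" and "\<alpha> < 1"
    and "positive_distribution u"
    and "X = (1 - \<alpha>) *\<^sub>R
           matrix_inv (mat 1 - \<alpha> *\<^sub>R (transition_matrix E + outer (dangling_vec E) u))"
  shows "pagerank_values E \<alpha> u i = {Min (range (\<lambda>j. X $ j $ i)) <..< X $ i $ i}"
proof -
  let ?S = "transition_matrix E + outer (dangling_vec E) u"
  let ?c = "column i X"
  note \<alpha> = assms(2,3) and u = assms(4) and X = assms(5)
  have c: "(mat 1 - \<alpha> *\<^sub>R ?S) *v ?c = (1 - \<alpha>) *\<^sub>R axis i 1"
    by (rule resolvent_column[OF row_stochastic_transition[OF u] \<alpha> X])
  have max: "?c $ j < ?c $ i" if "j \<noteq> i" for j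
    using resolvent_max_unique[OF row_stochastic_transition[OF u] \<alpha> c _ that] \<alpha> by simp
  have "Min (range (($) ?c)) \<in> range (($) ?c)" by (rule Min_in) auto
  then obtain k where k: "?c $ k = Min (range (($) ?c))" by (metis imageE)
  have lo: "?c $ k \<le> ?c $ j" for j unfolding k by (rule Min_le) auto
  have hi: "?c $ j \<le> ?c $ i" for j using max[of j] by (cases "j = i") auto
  \<comment> \<open>A second node \<open>j\<close> has an entry strictly below the diagonal one, so
    the minimum of the column is strictly below it too.\<close>
  have "card (UNIV :: 'n set) \<noteq> card {i}" using assms(1) by simp
  then obtain j where "j \<noteq> i" by (metis UNIV_eq_I singletonI)
  then have less: "?c $ k < ?c $ i" using max[of j] lo[of j] by simp
  \<comment> \<open>Moving \<open>X\<close> across the inner product turns \<open>axis i 1\<close>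
    into column \<open>i\<close> of \<open>X\<close>.\<close>
  have "pagerank E \<alpha> u v \<bullet> axis i 1 = v \<bullet> ?c" if "positive_distribution v" for v
    by (simp add: pagerank_eq[OF \<alpha> u that X] dot_lmul_matrix matrix_vector_mult_basis)
  then have "pagerank_values E \<alpha> u i = {v \<bullet> ?c | v. positive_distribution v}"
    unfolding pagerank_values_def by (metis (no_types, lifting))
  also have "\<dots> = {?c $ k<..<?c $ i}"
    by (rule positive_distribution_inner_values[OF lo hi less])
  finally show ?thesis
    unfolding k by (simp add: column_def cong: image_cong)
qed

end
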